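(* Let $X$ be the set of all $(p,u,v,w)$ with $p=(p_t)_{t\in\mathcal T}\in\mathbb R_{\ge 0}^{\mathcal T}$, $u=(u_t)_{t\in\mathcal T}\in\{0,1\}^{\mathcal T}$, $v=(v_t)_{t\in\mathcal T^0}\in\{0,1\}^{\mathcal T^0}$, $w=(w_t)_{t\in\mathcal T^0}\in\{0,1\}^{\mathcal T^0}$ satisfying $$\underline P\,u_t\le p_t\le \overline P\,u_t\quad\forall t\in\mathcal T,$$ $$u_t-u_{t-1}=v_t-w_t,\qquad v_t\le u_t,\qquad w_t\le 1-u_t\qquad\forall t\in\mathcal T^0 .$$ Then the convex hull of $X$ is exactly the set of all real $(p,u,v,w)\in\mathbb R^{\mathcal T}\times\mathbb R^{\mathcal T}\times\mathbb R^{\mathcal T^0}\times\mathbb R^{\mathcal T^0}$ satisfying $$\underline P\,u_t\le p_t\le \overline P\,u_t\quad\forall t\in\mathcal T,$$ $$u_t-u_{t-1}=v_t-w_t,\qquad v_t\le u_t,\qquad w_t\le 1-u_t,\qquad v_t\ge 0,\qquad w_t\ge 0\qquad\forall t\in\mathcal T^0 .$$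
   Context: Single-unit unit commitment problem (no demand balance constraint, no investment variable). $\mathcal T=\{t_0,t_0+1,\dots,t_{end}\}$ is a finite set of consecutive time periods with $t_0<t_{end}$, and $\mathcal T^0=\mathcal T\setminus\{t_0\}$. The parameters $0\le\underline P\le\overline P$ are the minimum and maximum output of the unit. The variable $p_t$ is the production, $u_t$ the commitment (up/down) status, $v_t$ the start-up indicator and $w_t$ the shut-down indicator of the unit in period $t$. *)

theory Defs
  imports "HOL-Analysis.Analysis" "HOL-Analysis.Finite_Function_Topology"
begin

text \<open>
  The space \<open>\<real>\<^sup>I\<close>, for a finite set \<open>I\<close> of integers, is taken to be the linear subspace of the
  finitely supported functions (type \<open>poly_mapping\<close>) that vanish outside \<open>I\<close>. This makes it possible to
  use \<open>convex hull\<close> from the library although \<open>I\<close> is not a type.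
\<close>

type_synonym vec = "(int, real) poly_mapping"

definition vec_space :: "int set \<Rightarrow> vec set" where
  "vec_space I = {f. Poly_Mapping.keys f \<subseteq> I}"

abbreviation entry :: "vec \<Rightarrow> int \<Rightarrow> real" where
  "entry \<equiv> Poly_Mapping.lookup"

lemma entry_scaleR [simp]: "entry (c *\<^sub>R f) i = c * entry f i"
proof -
  have "finite {i. c *\<^sub>R entry f i \<noteq> 0}"
    by (rule finite_subset[OF _ finite_keys[of f]]) (auto simp: in_keys_iff)
  then show ?thesis
    by (simp add: scaleR_poly_mapping_def)
qed

lemma vec_space_bij:
  assumes "finite I"
  shows "bij_betw (\<lambda>f. restrict (entry f) I) (vec_space I) (I \<rightarrow>\<^sub>E UNIV)"
proof (rule bij_betw_byWitness
    [where f' = "\<lambda>x. Abs_poly_mapping (\<lambda>i. if i \<in> I then x i else 0)"])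
  have *: "entry (Abs_poly_mapping (\<lambda>i. if i \<in> I then x i else 0))
      = (\<lambda>i. if i \<in> I then x i else 0)" for x :: "int \<Rightarrow> real"
    by (rule lookup_Abs_poly_mapping) (rule finite_subset[OF _ assms], auto)
  show "\<forall>f\<in>vec_space I. Abs_poly_mapping (\<lambda>i. if i \<in> I then restrict (entry f) I i else 0) = f"
    by (auto intro!: poly_mapping_eqI simp: * vec_space_def in_keys_iff)
  show "\<forall>x\<in>I \<rightarrow>\<^sub>E UNIV. restrict (entry (Abs_poly_mapping (\<lambda>i. if i \<in> I then x i else 0))) I = x"
    by (auto simp: * fun_eq_iff PiE_def extensional_def)
  show "(\<lambda>f. restrict (entry f) I) ` vec_space I \<subseteq> I \<rightarrow>\<^sub>E UNIV"
    by auto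
  show "(\<lambda>x. Abs_poly_mapping (\<lambda>i. if i \<in> I then x i else 0)) ` (I \<rightarrow>\<^sub>E UNIV) \<subseteq> vec_space I"
    by (auto simp: * vec_space_def in_keys_iff split: if_splits)
qed

type_synonym schedule =
  "vec \<times> vec \<times> vec \<times> vec"

definition schedule_space :: "int \<Rightarrow> int \<Rightarrow> schedule set" where
  "schedule_space t0 tend =
    vec_space {t0..tend} \<times> vec_space {t0..tend} \<times>
    vec_space ({t0..tend} - {t0}) \<times> vec_space ({t0..tend} - {t0})"

definition uc_feasible :: "real \<Rightarrow> real \<Rightarrow> int \<Rightarrow> int \<Rightarrow> schedule set" where
  "uc_feasible Pmin Pmax t0 tend = {(p, u, v, w) \<in> schedule_space t0 tend.
     (\<forall>t\<in>{t0..tend}. 0 \<le> entry p t \<and> entry u t \<in> {0, 1}) \<and>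
     (\<forall>t\<in>{t0..tend} - {t0}. entry v t \<in> {0, 1} \<and> entry w t \<in> {0, 1}) \<and>
     (\<forall>t\<in>{t0..tend}. Pmin * entry u t \<le> entry p t \<and> entry p t \<le> Pmax * entry u t) \<and>
     (\<forall>t\<in>{t0..tend} - {t0}.
        entry u t - entry u (t - 1) = entry v t - entry w t \<and>
        entry v t \<le> entry u t \<and> entry w t \<le> 1 - entry u t)}"

definition uc_polytope :: "real \<Rightarrow> real \<Rightarrow> int \<Rightarrow> int \<Rightarrow> schedule set" where
  "uc_polytope Pmin Pmax t0 tend = {(p, u, v, w) \<in> schedule_space t0 tend.
     (\<forall>t\<in>{t0..tend}. Pmin * entry u t \<le> entry p t \<and> entry p t \<le> Pmax * entry u t) \<and>
     (\<forall>t\<in>{t0..tend} - {t0}.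
        entry u t - entry u (t - 1) = entry v t - entry w t \<and>
        entry v t \<le> entry u t \<and> entry w t \<le> 1 - entry u t \<and>
        0 \<le> entry v t \<and> 0 \<le> entry w t)}"

end

theory Submission
  imports Defs
begin

text \<open>
  The constraints of the polytope say that the numbers
  \<open>u\<^sub>t - v\<^sub>t\<close>, \<open>v\<^sub>t\<close>, \<open>w\<^sub>t\<close>, \<open>1 - u\<^sub>t - w\<^sub>t\<close> form a probability distribution on the four possible
  transitions on-on, off-on, on-off, off-off from period \<open>t - 1\<close> to period \<open>t\<close>, and that the
  distributions for consecutive periods agree on the status in the period they share: it is on with
  probability \<open>u\<^sub>t\<close>. Such transition laws can be glued to a law on whole 0/1 paths, as for a Markov
  chain, and every 0/1 path is a feasible schedule. The expected schedule under this law is the given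
  point. The production needs no randomness of its own: whenever the unit is on in period \<open>t\<close>, let it
  produce \<open>q\<^sub>t = p\<^sub>t / u\<^sub>t\<close>, which lies in \<open>[Pmin, Pmax]\<close>; the mean is then \<open>q\<^sub>t u\<^sub>t = p\<^sub>t\<close>.
  If \<open>u\<^sub>t = 0\<close>, then \<open>p\<^sub>t = 0\<close> and every \<open>q\<^sub>t\<close> in \<open>[Pmin, Pmax]\<close> serves.

  The law on paths is not constructed explicitly. Instead, the gluing is an induction on the last period \<open>T\<close>
  (\<open>truncation_decomposition\<close>), in which the point cut off after \<open>T\<close> is written as
  \<open>u\<^sub>T y\<^sub>1 + (1 - u\<^sub>T) y\<^sub>0\<close>, where \<open>y\<^sub>1\<close> and \<open>y\<^sub>0\<close> are convex combinations of feasible schedules that end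
  on and off, respectively: these are the conditional expectations given the final status. Since the
  schedules up to \<open>T\<close> have zero entries after \<open>T\<close>, appending a period is a translation and
  commutes with taking convex hulls (\<open>hull_append_period\<close>).
\<close>

section \<open>Vectors and truncated schedules\<close>

lemma vec_space_iff: "f \<in> vec_space I \<longleftrightarrow> (\<forall>t. t \<notin> I \<longrightarrow> entry f t = 0)"
  by (auto simp: vec_space_def in_keys_iff)

definition vec_on :: "int set \<Rightarrow> (int \<Rightarrow> real) \<Rightarrow> vec" where
  "vec_on I f = (\<Sum>t\<in>I. Poly_Mapping.single t (f t))"

lemma entry_vec_on:
  assumes "finite I"
  shows "entry (vec_on I f) t = (if t \<in> I then f t else 0)"
  using assms by (simp add: vec_on_def lookup_sum lookup_single when_def)

lemma vec_on_entry:
  assumes "finite I" "x \<in> vec_space I"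
  shows "vec_on I (entry x) = x"
  using assms by (intro poly_mapping_eqI) (simp add: entry_vec_on vec_space_iff)

definition truncated :: "int \<Rightarrow> int \<Rightarrow> schedule \<Rightarrow> schedule" where
  "truncated t0 T = (\<lambda>(p, u, v, w). (vec_on {t0..T} (entry p), vec_on {t0..T} (entry u),
     vec_on ({t0..T} - {t0}) (entry v), vec_on ({t0..T} - {t0}) (entry w)))"

definition single_period :: "int \<Rightarrow> real \<Rightarrow> real \<Rightarrow> real \<Rightarrow> real \<Rightarrow> schedule" where
  "single_period t p u v w = (Poly_Mapping.single t p, Poly_Mapping.single t u,
     Poly_Mapping.single t v, Poly_Mapping.single t w)"

lemma truncated_start:
  "truncated t0 t0 (p, u, v, w) = single_period t0 (entry p t0) (entry u t0) 0 0"
  by (simp add: truncated_def single_period_def vec_on_def)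

lemma truncated_step:
  assumes "t0 \<le> T"
  shows "truncated t0 (T + 1) (p, u, v, w) = truncated t0 T (p, u, v, w)
    + single_period (T + 1) (entry p (T + 1)) (entry u (T + 1)) (entry v (T + 1)) (entry w (T + 1))"
proof -
  have "{t0..T + 1} = insert (T + 1) {t0..T}"
    and "{t0..T + 1} - {t0} = insert (T + 1) ({t0..T} - {t0})"
    using assms by auto
  then show ?thesis
    by (simp add: truncated_def single_period_def vec_on_def add.commute)
qed

lemma truncated_all:
  assumes "x \<in> schedule_space t0 tend"
  shows "truncated t0 tend x = x"
  using assms by (auto simp: truncated_def schedule_space_def vec_on_entry)

lemma single_period_add:
  "single_period t p u v w + single_period t p' u' v' w'
     = single_period t (p + p') (u + u') (v + v') (w + w')"
  by (simp add: single_period_def single_add)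

lemma single_period_scaleR:
  "c *\<^sub>R single_period t p u v w = single_period t (c * p) (c * u) (c * v) (c * w)"
  by (auto simp: single_period_def lookup_single when_def intro!: poly_mapping_eqI)

section \<open>The polytope contains the hull\<close>

lemma convex_uc_polytope: "convex (uc_polytope Pmin Pmax t0 tend)"
  unfolding convex_def
proof (intro ballI allI impI)
  fix x y and a b :: real
  assume x: "x \<in> uc_polytope Pmin Pmax t0 tend" and y: "y \<in> uc_polytope Pmin Pmax t0 tend"
    and ab: "0 \<le> a" "0 \<le> b" "a + b = 1"
  obtain p u v w where x_eq: "x = (p, u, v, w)" by (cases x) auto
  obtain p' u' v' w' where y_eq: "y = (p', u', v', w')" by (cases y) auto
  have combine: "a * l1 + b * l2 \<le> a * r1 + b * r2" if "l1 \<le> r1" "l2 \<le> r2" for l1 l2 r1 r2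
    using that ab by (intro add_mono mult_left_mono)
  have space: "a *\<^sub>R x + b *\<^sub>R y \<in> schedule_space t0 tend"
    using x y by (simp add: x_eq y_eq uc_polytope_def schedule_space_def vec_space_iff lookup_add)
  have production: "Pmin * (a * entry u t + b * entry u' t) \<le> a * entry p t + b * entry p' t"
    "a * entry p t + b * entry p' t \<le> Pmax * (a * entry u t + b * entry u' t)"
    if "t \<in> {t0..tend}" for t
  proof -
    have "Pmin * entry u t \<le> entry p t" "entry p t \<le> Pmax * entry u t"
      using x that unfolding x_eq uc_polytope_def by blast+
    moreover have "Pmin * entry u' t \<le> entry p' t" "entry p' t \<le> Pmax * entry u' t"
      using y that unfolding y_eq uc_polytope_def by blast+
    ultimately show "Pmin * (a * entry u t + b * entry u' t) \<le> a * entry p t + b * entry p' t"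
      "a * entry p t + b * entry p' t \<le> Pmax * (a * entry u t + b * entry u' t)"
      using combine[of "Pmin * entry u t" "entry p t" "Pmin * entry u' t" "entry p' t"]
        combine[of "entry p t" "Pmax * entry u t" "entry p' t" "Pmax * entry u' t"]
      by (simp_all add: algebra_simps)
  qed
  have change: "(a * entry u t + b * entry u' t) - (a * entry u (t - 1) + b * entry u' (t - 1))
      = (a * entry v t + b * entry v' t) - (a * entry w t + b * entry w' t)
    \<and> a * entry v t + b * entry v' t \<le> a * entry u t + b * entry u' t
    \<and> a * entry w t + b * entry w' t \<le> 1 - (a * entry u t + b * entry u' t)
    \<and> 0 \<le> a * entry v t + b * entry v' t \<and> 0 \<le> a * entry w t + b * entry w' t"
    if "t \<in> {t0..tend} - {t0}" for t
  proof -
    have 1: "entry u t - entry u (t - 1) = entry v t - entry w t"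
      "entry v t \<le> entry u t" "entry w t \<le> 1 - entry u t" "0 \<le> entry v t" "0 \<le> entry w t"
      using x that unfolding x_eq uc_polytope_def by blast+
    have 2: "entry u' t - entry u' (t - 1) = entry v' t - entry w' t"
      "entry v' t \<le> entry u' t" "entry w' t \<le> 1 - entry u' t" "0 \<le> entry v' t" "0 \<le> entry w' t"
      using y that unfolding y_eq uc_polytope_def by blast+
    have "a * (entry u t - entry u (t - 1)) + b * (entry u' t - entry u' (t - 1))
        = a * (entry v t - entry w t) + b * (entry v' t - entry w' t)"
      by (simp add: 1(1) 2(1))
    moreover have "a * (1 - entry u t) + b * (1 - entry u' t) = 1 - (a * entry u t + b * entry u' t)"
      using ab(3) by (simp add: algebra_simps)
    ultimately show ?thesis
      using combine[OF 1(2) 2(2)] combine[OF 1(3) 2(3)] combine[OF 1(4) 2(4)] combine[OF 1(5) 2(5)]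
      by (simp add: algebra_simps)
  qed
  show "a *\<^sub>R x + b *\<^sub>R y \<in> uc_polytope Pmin Pmax t0 tend"
    using space production change by (simp add: x_eq y_eq uc_polytope_def lookup_add)
qed

lemma uc_feasible_subset_polytope: "uc_feasible Pmin Pmax t0 tend \<subseteq> uc_polytope Pmin Pmax t0 tend"
proof -
  have "0 \<le> c" if "c \<in> {0, 1}" for c :: real
    using that by auto
  then show ?thesis
    unfolding uc_feasible_def uc_polytope_def by blast
qed

section \<open>Gluing the transition laws\<close>

definition feasible_ending :: "real \<Rightarrow> real \<Rightarrow> int \<Rightarrow> int \<Rightarrow> real \<Rightarrow> schedule set" where
  "feasible_ending Pmin Pmax t0 T b = {(p, u, v, w) \<in> uc_feasible Pmin Pmax t0 T. entry u T = b}"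

text \<open>
  The start-up and shut-down indicators of a period are determined by the statuses \<open>a\<close> and \<open>b\<close> before
  and in that period: their products \<open>(1 - a) b\<close> and \<open>a (1 - b)\<close> are the indicators of the two changes.
\<close>

lemma append_period_feasible:
  assumes "t0 \<le> T" "0 \<le> Pmin" "Pmin \<le> q" "q \<le> Pmax" "a \<in> {0, 1}" "b \<in> {0, 1}"
    and "x \<in> feasible_ending Pmin Pmax t0 T a"
  shows "single_period (T + 1) (q * b) b ((1 - a) * b) (a * (1 - b)) + x
    \<in> feasible_ending Pmin Pmax t0 (T + 1) b"
proof -
  obtain p u v w where x: "x = (p, u, v, w)" by (cases x) auto
  have space: "x \<in> schedule_space t0 T" and last: "entry u T = a"
    and old: "\<forall>t\<in>{t0..T}. 0 \<le> entry p t \<and> entry u t \<in> {0, 1}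
        \<and> Pmin * entry u t \<le> entry p t \<and> entry p t \<le> Pmax * entry u t"
    and old': "\<forall>t\<in>{t0..T} - {t0}. entry v t \<in> {0, 1} \<and> entry w t \<in> {0, 1}
        \<and> entry u t - entry u (t - 1) = entry v t - entry w t
        \<and> entry v t \<le> entry u t \<and> entry w t \<le> 1 - entry u t"
    using assms(7) by (auto simp: x feasible_ending_def uc_feasible_def)
  have fresh: "entry p (T + 1) = 0" "entry u (T + 1) = 0" "entry v (T + 1) = 0" "entry w (T + 1) = 0"
    using space by (auto simp: x schedule_space_def vec_space_iff)
  define p' where "p' = Poly_Mapping.single (T + 1) (q * b) + p"
  define u' where "u' = Poly_Mapping.single (T + 1) b + u"
  define v' where "v' = Poly_Mapping.single (T + 1) ((1 - a) * b) + v"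
  define w' where "w' = Poly_Mapping.single (T + 1) (a * (1 - b)) + w"
  note defs = p'_def u'_def v'_def w'_def
  have new: "entry p' (T + 1) = q * b" "entry u' (T + 1) = b" "entry u' T = a"
    "entry v' (T + 1) = (1 - a) * b" "entry w' (T + 1) = a * (1 - b)"
    using fresh last by (simp_all add: defs lookup_add lookup_single)
  have keep: "entry p' t = entry p t" "entry u' t = entry u t"
    "entry v' t = entry v t" "entry w' t = entry w t" if "t \<noteq> T + 1" for t
    using that by (simp_all add: defs lookup_add lookup_single when_def)
  have "(p', u', v', w') \<in> schedule_space t0 (T + 1)"
    using space assms(1)
    by (auto simp: x schedule_space_def vec_space_iff defs lookup_add lookup_single when_def)
  moreover have "0 \<le> entry p' t \<and> entry u' t \<in> {0, 1}
      \<and> Pmin * entry u' t \<le> entry p' t \<and> entry p' t \<le> Pmax * entry u' t"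
    if "t \<in> {t0..T + 1}" for t
  proof (cases "t = T + 1")
    case True
    show ?thesis using assms(2-6) unfolding True new by auto
  next
    case False
    then show ?thesis using that old unfolding keep[OF False] by auto
  qed
  moreover have "entry v' t \<in> {0, 1} \<and> entry w' t \<in> {0, 1}
      \<and> entry u' t - entry u' (t - 1) = entry v' t - entry w' t
      \<and> entry v' t \<le> entry u' t \<and> entry w' t \<le> 1 - entry u' t"
    if "t \<in> {t0..T + 1} - {t0}" for t
  proof (cases "t = T + 1")
    case True
    then have "t - 1 = T" by simp
    then show ?thesis using assms(5,6) unfolding True by (auto simp: new)
  next
    case False
    then have "t \<in> {t0..T} - {t0}" "t - 1 \<noteq> T + 1" using that by auto
    then show ?thesis using old' by (simp add: keep[OF False] keep[of "t - 1"])
  qed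
  ultimately have "(p', u', v', w') \<in> feasible_ending Pmin Pmax t0 (T + 1) b"
    by (simp add: feasible_ending_def uc_feasible_def new(2))
  then show ?thesis by (simp add: x single_period_def defs)
qed

lemma hull_append_period:
  assumes "t0 \<le> T" "0 \<le> Pmin" "Pmin \<le> q" "q \<le> Pmax" "a \<in> {0, 1}" "b \<in> {0, 1}"
    and "x \<in> convex hull feasible_ending Pmin Pmax t0 T a"
  shows "single_period (T + 1) (q * b) b ((1 - a) * b) (a * (1 - b)) + x
    \<in> convex hull feasible_ending Pmin Pmax t0 (T + 1) b"
proof -
  let ?e = "single_period (T + 1) (q * b) b ((1 - a) * b) (a * (1 - b))"
  have "(+) ?e ` feasible_ending Pmin Pmax t0 T a \<subseteq> feasible_ending Pmin Pmax t0 (T + 1) b"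
    using append_period_feasible[OF assms(1-6)] by auto
  then have "convex hull ((+) ?e ` feasible_ending Pmin Pmax t0 T a)
      \<subseteq> convex hull feasible_ending Pmin Pmax t0 (T + 1) b"
    by (rule hull_mono)
  then show ?thesis
    using assms(7) by (auto simp: convex_hull_translation)
qed

text \<open>
  The case \<open>a + b = 0\<close> is included, so that conditioning on a final status of probability zero
  needs no separate treatment.
\<close>

lemma convex_combine_nonneg:
  assumes "convex S" "x \<in> S" "y \<in> S" "0 \<le> a" "0 \<le> b"
  obtains z where "z \<in> S" "a *\<^sub>R x + b *\<^sub>R y = (a + b) *\<^sub>R z"
proof (cases "a + b = 0")
  case True
  with assms that[of x] show ?thesis by (simp add: add_nonneg_eq_0_iff)
next
  case False
  let ?z = "(a / (a + b)) *\<^sub>R x + (b / (a + b)) *\<^sub>R y"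
  have "?z \<in> S"
    using assms False by (intro convexD) (auto simp flip: add_divide_distrib)
  moreover have "a *\<^sub>R x + b *\<^sub>R y = (a + b) *\<^sub>R ?z"
    using False by (simp add: scaleR_right_distrib)
  ultimately show ?thesis using that by blast
qed

text \<open>
  The first period has no start-up and shut-down variables that bound its status; there the bounds come
  from the second period, as \<open>u\<^bsub>t-1\<^esub> = (u\<^sub>t - v\<^sub>t) + w\<^sub>t\<close> and \<open>1 - u\<^bsub>t-1\<^esub> = v\<^sub>t + (1 - u\<^sub>t - w\<^sub>t)\<close>.
\<close>

lemma uc_polytope_status:
  assumes "(p, u, v, w) \<in> uc_polytope Pmin Pmax t0 tend" "t0 < tend" "t \<in> {t0..tend}"
  shows "0 \<le> entry u t" "entry u t \<le> 1"
proof -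
  have "0 \<le> entry u t \<and> entry u t \<le> 1"
  proof (cases "t = t0")
    case True
    have "t0 + 1 \<in> {t0..tend} - {t0}" using assms(2) by auto
    then have "entry u (t0 + 1) - entry u (t0 + 1 - 1) = entry v (t0 + 1) - entry w (t0 + 1)"
      "entry v (t0 + 1) \<le> entry u (t0 + 1)" "entry w (t0 + 1) \<le> 1 - entry u (t0 + 1)"
      "0 \<le> entry v (t0 + 1)" "0 \<le> entry w (t0 + 1)"
      using assms(1) unfolding uc_polytope_def by blast+
    then show ?thesis unfolding True by simp
  next
    case False
    with assms(3) have "t \<in> {t0..tend} - {t0}" by auto
    then have "entry v t \<le> entry u t" "entry w t \<le> 1 - entry u t" "0 \<le> entry v t" "0 \<le> entry w t"
      using assms(1) unfolding uc_polytope_def by blast+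
    then show ?thesis by simp
  qed
  then show "0 \<le> entry u t" "entry u t \<le> 1" by auto
qed

lemma constant_output_when_on:
  fixes p u Pmin Pmax :: real
  assumes "Pmin \<le> Pmax" "0 \<le> u" "Pmin * u \<le> p" "p \<le> Pmax * u"
  obtains q where "Pmin \<le> q" "q \<le> Pmax" "p = q * u"
proof (cases "u = 0")
  case True
  with assms that[of Pmin] show ?thesis by simp
next
  case False
  with assms that[of "p / u"] show ?thesis by (simp add: field_simps)
qed

lemma regroup_by_transition:
  fixes y1 y0 e11 e01 e10 e00 :: "'a::real_vector" and u v w :: real
  shows "((u - v + w) *\<^sub>R y1 + (1 - (u - v + w)) *\<^sub>R y0)
      + ((u - v) *\<^sub>R e11 + v *\<^sub>R e01 + (w *\<^sub>R e10 + (1 - u - w) *\<^sub>R e00))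
    = ((u - v) *\<^sub>R (e11 + y1) + v *\<^sub>R (e01 + y0))
      + (w *\<^sub>R (e10 + y1) + (1 - u - w) *\<^sub>R (e00 + y0))"
  by (simp add: algebra_simps)

lemma truncation_decomposition:
  assumes x: "(p, u, v, w) \<in> uc_polytope Pmin Pmax t0 tend"
    and P: "t0 < tend" "0 \<le> Pmin" "Pmin \<le> Pmax"
    and T: "t0 \<le> T" "T \<le> tend"
  shows "\<exists>y1 \<in> convex hull feasible_ending Pmin Pmax t0 T 1.
         \<exists>y0 \<in> convex hull feasible_ending Pmin Pmax t0 T 0.
           truncated t0 T (p, u, v, w) = entry u T *\<^sub>R y1 + (1 - entry u T) *\<^sub>R y0"
  using T
proof (induction T rule: int_ge_induct)
  case base
  have "Pmin * entry u t0 \<le> entry p t0" "entry p t0 \<le> Pmax * entry u t0"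
    using x P by (auto simp: uc_polytope_def)
  then obtain q where q: "Pmin \<le> q" "q \<le> Pmax" "entry p t0 = q * entry u t0"
    using uc_polytope_status(1)[OF x P(1), of t0] P
      constant_output_when_on[of Pmin Pmax "entry u t0" "entry p t0"] by auto
  have *: "single_period t0 (q * b) b 0 0 \<in> feasible_ending Pmin Pmax t0 t0 b"
    if "b \<in> {0, 1}" for b
    using that q P by (auto simp: feasible_ending_def uc_feasible_def schedule_space_def
        vec_space_iff single_period_def lookup_single when_def)
  have "truncated t0 t0 (p, u, v, w) = entry u t0 *\<^sub>R single_period t0 (q * 1) 1 0 0
      + (1 - entry u t0) *\<^sub>R single_period t0 (q * 0) 0 0 0"
    by (simp add: truncated_start single_period_scaleR single_period_add q(3) mult.commute)
  then show ?case
    using *[of 1] *[of 0] by (blast intro: hull_inc)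
next
  case (step T)
  let ?F = "feasible_ending Pmin Pmax t0 (T + 1)"
  let ?u = "entry u (T + 1)" and ?v = "entry v (T + 1)" and ?w = "entry w (T + 1)"
  let ?e = "\<lambda>q a b. single_period (T + 1) (q * b) b ((1 - a) * b) (a * (1 - b))"
  obtain y1 y0 where y1: "y1 \<in> convex hull feasible_ending Pmin Pmax t0 T 1"
    and y0: "y0 \<in> convex hull feasible_ending Pmin Pmax t0 T 0"
    and y: "truncated t0 T (p, u, v, w) = entry u T *\<^sub>R y1 + (1 - entry u T) *\<^sub>R y0"
    using step by auto
  have mem: "T + 1 \<in> {t0..tend} - {t0}" "T + 1 \<in> {t0..tend}"
    using step by auto
  have "entry u (T + 1) - entry u (T + 1 - 1) = ?v - ?w"
    and bounds: "?v \<le> ?u" "?w \<le> 1 - ?u" "0 \<le> ?v" "0 \<le> ?w"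
    using x mem(1) unfolding uc_polytope_def by blast+
  then have uT: "entry u T = ?u - ?v + ?w" by simp
  have "Pmin * ?u \<le> entry p (T + 1)" "entry p (T + 1) \<le> Pmax * ?u"
    using x mem(2) unfolding uc_polytope_def by blast+
  then obtain q where q: "Pmin \<le> q" "q \<le> Pmax" "entry p (T + 1) = q * ?u"
    using uc_polytope_status(1)[OF x P(1) mem(2)] P constant_output_when_on by metis
  note app = hull_append_period[OF step(1) P(2) q(1,2)]
  have on: "?e q 1 1 + y1 \<in> convex hull ?F 1" "?e q 0 1 + y0 \<in> convex hull ?F 1"
    and off: "?e q 1 0 + y1 \<in> convex hull ?F 0" "?e q 0 0 + y0 \<in> convex hull ?F 0"
    using app[OF _ _ y1] app[OF _ _ y0] by blast+
  have weights: "0 \<le> ?u - ?v" "0 \<le> 1 - ?u - ?w" using bounds by simp_all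
  obtain z1 where z1: "z1 \<in> convex hull ?F 1"
    "(?u - ?v) *\<^sub>R (?e q 1 1 + y1) + ?v *\<^sub>R (?e q 0 1 + y0) = (?u - ?v + ?v) *\<^sub>R z1"
    by (rule convex_combine_nonneg[OF convex_convex_hull on weights(1) bounds(3)])
  obtain z0 where z0: "z0 \<in> convex hull ?F 0"
    "?w *\<^sub>R (?e q 1 0 + y1) + (1 - ?u - ?w) *\<^sub>R (?e q 0 0 + y0) = (?w + (1 - ?u - ?w)) *\<^sub>R z0"
    by (rule convex_combine_nonneg[OF convex_convex_hull off bounds(4) weights(2)])
  \<comment> \<open>The four transitions on-on, off-on, on-off, off-off, weighted by their probabilities.\<close>
  have e: "single_period (T + 1) (entry p (T + 1)) ?u ?v ?w
      = (?u - ?v) *\<^sub>R ?e q 1 1 + ?v *\<^sub>R ?e q 0 1 + (?w *\<^sub>R ?e q 1 0 + (1 - ?u - ?w) *\<^sub>R ?e q 0 0)"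
    unfolding single_period_scaleR single_period_add q(3) by (simp add: algebra_simps)
  have "truncated t0 (T + 1) (p, u, v, w)
      = (entry u T *\<^sub>R y1 + (1 - entry u T) *\<^sub>R y0)
        + single_period (T + 1) (entry p (T + 1)) ?u ?v ?w"
    using truncated_step[OF step(1)] y by simp
  also have "\<dots> = ((?u - ?v) *\<^sub>R (?e q 1 1 + y1) + ?v *\<^sub>R (?e q 0 1 + y0))
      + (?w *\<^sub>R (?e q 1 0 + y1) + (1 - ?u - ?w) *\<^sub>R (?e q 0 0 + y0))"
    unfolding e uT by (rule regroup_by_transition)
  also have "\<dots> = ?u *\<^sub>R z1 + (1 - ?u) *\<^sub>R z0"
    unfolding z1(2) z0(2) by simp
  finally show ?case using z1(1) z0(1) by blast
qed

theorem mainTheorem1: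
  fixes Pmin Pmax :: real and t0 tend :: int
  assumes "t0 < tend" and "0 \<le> Pmin" and "Pmin \<le> Pmax"
  shows "convex hull (uc_feasible Pmin Pmax t0 tend) = uc_polytope Pmin Pmax t0 tend"
proof
  show "convex hull (uc_feasible Pmin Pmax t0 tend) \<subseteq> uc_polytope Pmin Pmax t0 tend"
    by (intro hull_minimal uc_feasible_subset_polytope convex_uc_polytope)
next
  show "uc_polytope Pmin Pmax t0 tend \<subseteq> convex hull (uc_feasible Pmin Pmax t0 tend)"
  proof
    fix x assume x: "x \<in> uc_polytope Pmin Pmax t0 tend"
    obtain p u v w where x_eq: "x = (p, u, v, w)" by (cases x) auto
    have "feasible_ending Pmin Pmax t0 tend b \<subseteq> uc_feasible Pmin Pmax t0 tend" for b
      by (auto simp: feasible_ending_def)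
    then have sub: "convex hull feasible_ending Pmin Pmax t0 tend b
        \<subseteq> convex hull uc_feasible Pmin Pmax t0 tend" for b
      by (rule hull_mono)
    obtain y1 y0 where y: "y1 \<in> convex hull uc_feasible Pmin Pmax t0 tend"
      "y0 \<in> convex hull uc_feasible Pmin Pmax t0 tend"
      "truncated t0 tend x = entry u tend *\<^sub>R y1 + (1 - entry u tend) *\<^sub>R y0"
      using truncation_decomposition[OF x[unfolded x_eq] assms, of tend] assms(1) sub
      unfolding x_eq by fastforce
    moreover have "0 \<le> entry u tend" "entry u tend \<le> 1"
      using uc_polytope_status[OF x[unfolded x_eq] assms(1), of tend] assms(1) by auto
    ultimately have "truncated t0 tend x \<in> convex hull uc_feasible Pmin Pmax t0 tend"
      by (auto intro: convexD)
    moreover have "x \<in> schedule_space t0 tend"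
      using x by (auto simp: uc_polytope_def)
    ultimately show "x \<in> convex hull uc_feasible Pmin Pmax t0 tend"
      by (simp add: truncated_all)
  qed
qed

end
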